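(* Let $(X,d)$ be a Polish metric space, let $0\le n<\infty$, and let $\mu,\nu\in P_n(X)$. Then $T_\mu^n=T_\nu^n$ if and only if $\mu=\nu$.
   Context: $P(X)$ denotes the set of Borel probability measures on $X$. $\Lambda(X)$ denotes the set of all 1-Lipschitz functions $f\colon X\to\mathbb{R}$. For $f\in\Lambda(X)$ and $\mu\in P(X)$, $f_\sharp\mu(U)=\mu(f^{-1}(U))$ for Borel $U\subseteq\mathbb{R}$. For $a\in X$ let $f_a(x)=d(x,a)$. Let $f\wedge g$ denote the pointwise minimum. Let $I=[0,1]$. For $\alpha=(\alpha_0,\dots,\alpha_n)\in I^{n+1}$ and $a=(a_0,\dots,a_n)\in X^{n+1}$ (points not necessarily distinct), set $f_a^\alpha=\alpha_0 f_{a_0}\wedge\cdots\wedge\alpha_n f_{a_n}\in\Lambda(X)$, and $\Lambda_n(X)=\{f_a^\alpha : \alpha\in I^{n+1},\ a\in X^{n+1}\}$. The $n$-distance transform $T_\mu^n\colon\Lambda_n(X)\to P(\mathbb{R})$ is $T_\mu^n(f)=f_\sharp\mu$. A closed subset $S\subseteq X$ has covering dimension by balls $\le n$ if any cover of $S$ by open sets in $X$ can be refined to a cover of $S$ by open balls of $X$ such that no sub-collection of $k$ distinct balls in the refinement has non-empty intersection if $k>n+1$. The metric covering dimension $\xi_X(S)$ of $S$ in $X$ is the infimum of the integers $n\ge 0$ such that $S$ has covering dimension by balls $\le n$ (and $\infty$ if there is no such $n$). For $0\le n<\infty$, $\Omega_n(X)=\{\mu\in P(X) : \xi_X(\operatorname{supp}\mu)\le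 n\}$. Finally, $P_0(X)=\Omega_0(X)$ and $P_n(X)=\Omega_n(X)\setminus\Omega_{n-1}(X)$ for $1\le n<\infty$ (measures whose supports have metric covering dimension exactly $n$). *)

theory Defs
  imports "HOL-Probability.Probability"
begin

definition borel_probs :: "'a::topological_space measure set" where
  "borel_probs = {M. prob_space M \<and> sets M = sets borel}"

definition lip1_fns :: "('a::metric_space \<Rightarrow> real) set" where
  "lip1_fns = {f. 1-lipschitz_on UNIV f}"

text \<open>An (n+1)-tuple is represented by a function on \<^typ>\<open>nat\<close>, of which only the
  values at \<open>0, \<dots>, n\<close> are used.\<close>

definition min_dist :: "nat \<Rightarrow> (nat \<Rightarrow> real) \<Rightarrow> (nat \<Rightarrow> 'a::metric_space) \<Rightarrow> 'a \<Rightarrow> real" where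
  "min_dist n \<alpha> a = (\<lambda>x. MIN i\<in>{..n}. \<alpha> i * dist x (a i))"

definition min_dist_fns :: "nat \<Rightarrow> ('a::metric_space \<Rightarrow> real) set" where
  "min_dist_fns n = {min_dist n \<alpha> a |\<alpha> a. \<forall>i\<le>n. \<alpha> i \<in> {0..1}}"

definition dist_transform ::
    "nat \<Rightarrow> 'a::metric_space measure \<Rightarrow> ('a \<Rightarrow> real) \<Rightarrow> real measure" where
  "dist_transform n \<mu> = (\<lambda>f\<in>min_dist_fns n. distr \<mu> borel f)"

definition msupport :: "'a::topological_space measure \<Rightarrow> 'a set" where
  "msupport \<mu> = {x. \<forall>U. open U \<longrightarrow> x \<in> U \<longrightarrow> emeasure \<mu> U > 0}"

text \<open>Balls are counted as sets: two balls are distinct if they differ as subsets of the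
  space, whatever their centres and radii.\<close>

definition ball_dim_le :: "'a::metric_space set \<Rightarrow> nat \<Rightarrow> bool" where
  "ball_dim_le S n \<longleftrightarrow>
     (\<forall>\<U>. (\<forall>U\<in>\<U>. open U) \<and> S \<subseteq> \<Union>\<U> \<longrightarrow>
       (\<exists>\<B>. (\<forall>B\<in>\<B>. \<exists>x r. 0 < r \<and> B = ball x r) \<and> S \<subseteq> \<Union>\<B> \<and>
            (\<forall>B\<in>\<B>. \<exists>U\<in>\<U>. B \<subseteq> U) \<and>
            (\<forall>\<C>\<subseteq>\<B>. finite \<C> \<and> card \<C> > n + 1 \<longrightarrow> \<Inter>\<C> = {})))"

text \<open>In \<^typ>\<open>enat\<close> the infimum of the empty set is \<open>\<infinity>\<close>.\<close>

definition metric_cov_dim :: "'a::metric_space set \<Rightarrow> enat" where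
  "metric_cov_dim S = Inf {enat n |n. ball_dim_le S n}"

definition probs_dim_le :: "nat \<Rightarrow> 'a::metric_space measure set" where
  "probs_dim_le n = {\<mu> \<in> borel_probs. metric_cov_dim (msupport \<mu>) \<le> enat n}"

definition probs_dim :: "nat \<Rightarrow> 'a::metric_space measure set" where
  "probs_dim n = (if n = 0 then probs_dim_le 0 else probs_dim_le n - probs_dim_le (n - 1))"

lemma closed_msupport: "closed (msupport \<mu>)"
proof -
  have "- msupport \<mu> = \<Union>{U. open U \<and> \<not> emeasure \<mu> U > 0}"
    unfolding msupport_def by blast
  moreover have "open (\<Union>{U. open U \<and> \<not> emeasure \<mu> U > 0})"
    by (rule open_Union) blast
  ultimately show ?thesis
    by (simp add: closed_def)
qed

lemma min_dist_fns_lip1: "min_dist_fns n \<subseteq> lip1_fns"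
proof
  fix f :: "'a \<Rightarrow> real"
  assume "f \<in> min_dist_fns n"
  then obtain \<alpha> a where f: "f = min_dist n \<alpha> a" and \<alpha>: "\<And>i. i \<le> n \<Longrightarrow> \<alpha> i \<in> {0..1}"
    unfolding min_dist_fns_def by blast
  have le: "f x \<le> f y + dist x y" for x y
  proof -
    have "f y \<in> (\<lambda>i. \<alpha> i * dist y (a i)) ` {..n}"
      unfolding f min_dist_def by (rule Min_in) auto
    then obtain i where i: "i \<le> n" "f y = \<alpha> i * dist y (a i)"
      by auto
    have "f x \<le> \<alpha> i * dist x (a i)"
      unfolding f min_dist_def using i by (intro Min_le) auto
    also have "\<dots> \<le> \<alpha> i * (dist x y + dist y (a i))"
      using \<alpha>[OF i(1)] by (intro mult_left_mono dist_triangle) auto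
    also have "\<dots> = \<alpha> i * dist x y + f y"
      by (simp add: i distrib_left)
    also have "\<alpha> i * dist x y \<le> dist x y"
      using \<alpha>[OF i(1)] by (intro mult_left_le_one_le) auto
    finally show ?thesis by simp
  qed
  have "dist (f x) (f y) \<le> 1 * dist x y" for x y
    using le[of x y] le[of y x] by (simp add: dist_real_def dist_commute abs_le_iff)
  then show "f \<in> lip1_fns"
    unfolding lip1_fns_def by (auto intro: lipschitz_onI)
qed

lemma lip1_fns_measurable:
  assumes "f \<in> lip1_fns" "\<mu> \<in> borel_probs"
  shows "f \<in> borel_measurable \<mu>"
proof -
  have "continuous_on UNIV f"
    using assms(1) unfolding lip1_fns_def by (auto intro: lipschitz_on_continuous_on)
  then show ?thesis
    using assms(2) measurable_cong_sets[of \<mu> borel borel borel]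
    by (auto simp: borel_probs_def intro: borel_measurable_continuous_onI)
qed

lemma dist_transform_in_borel_probs:
  assumes "\<mu> \<in> borel_probs" "f \<in> min_dist_fns n"
  shows "dist_transform n \<mu> f \<in> borel_probs"
  using assms lip1_fns_measurable[of f \<mu>] min_dist_fns_lip1[of n]
  by (auto simp: dist_transform_def borel_probs_def intro: prob_space.prob_space_distr)

end

theory Submission
  imports Defs
begin

text \<open>
  For \<open>t > 0\<close> and positive weights, the sublevel set \<open>{f < t}\<close> of
  \<open>f = \<alpha>\<^sub>0 d(\<cdot>, a\<^sub>0) \<and> \<dots> \<and> \<alpha>\<^sub>n d(\<cdot>, a\<^sub>n)\<close> is the union of the balls of
  radius \<open>t / \<alpha>\<^sub>i\<close> about \<open>a\<^sub>i\<close>, and every family of at most \<open>n + 1\<close> balls arises in this way. So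
  two measures with the same \<open>n\<close>-distance transform agree on unions of at most \<open>n + 1\<close> balls.

  Solving the inclusion-exclusion formula for its last term shows, by induction on the number of
  balls, that they also agree on intersections of at most \<open>n + 1\<close> balls. Now take a finite family
  of balls, of any size, in which more than \<open>n + 1\<close> distinct balls never meet: all terms of the
  inclusion-exclusion formula for its union are either intersections of at most \<open>n + 1\<close> balls or
  vanish, so the measures agree on this union too
  (\<open>zero_on_Union_of_bounded_multiplicity\<close>). By second countability and continuity from below the
  same holds for infinite families of bounded multiplicity (\<open>measure_Union_balls_eq\<close>).

  Such families are what the dimension hypothesis provides. Let \<open>K\<close> be closed and \<open>U \<supseteq> K\<close> open.
  A covering of the support of \<open>\<mu>\<close> by balls of multiplicity at most \<open>n + 1\<close> that refines
  \<open>{U, - K}\<close> has a subfamily lying in \<open>U\<close> and covering \<open>K\<close> up to a \<open>\<mu>\<close>-null set. Hence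
  \<open>\<mu> K \<le> \<nu> U\<close> (\<open>measure_closed_le_open\<close>), outer regularity of \<open>\<nu>\<close> gives \<open>\<mu> K \<le> \<nu> K\<close>, and by
  symmetry the measures agree on closed sets, which generate the Borel sets and are stable under
  intersection.
\<close>

section \<open>Inclusion-exclusion for families of bounded multiplicity\<close>

text \<open>For a difference \<open>h\<close> of two finite measures, vanishing of \<open>h\<close> expresses that the measures
  agree; arguing with \<open>h\<close> avoids comparing two inclusion-exclusion sums term by term. In the sum
  for \<open>h (\<Union>C)\<close> every term but the one for \<open>C\<close> itself involves a smaller intersection and is zero
  by induction.\<close>

lemma zero_on_small_Inter:
  fixes h :: "'a set \<Rightarrow> real"
  assumes IE: "Incl_Excl P h" and "finite D" and P: "\<And>S. S \<in> D \<Longrightarrow> P S"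
    and small: "\<And>C. C \<subseteq> D \<Longrightarrow> C \<noteq> {} \<Longrightarrow> card C \<le> N \<Longrightarrow> h (\<Union>C) = 0"
    and "C \<subseteq> D" and "C \<noteq> {}" and "card C \<le> N"
  shows "h (\<Inter>C) = 0"
  using assms(5-)
proof (induction "card C" arbitrary: C rule: less_induct)
  case less
  have fin: "finite C"
    using less.prems(1) \<open>finite D\<close> finite_subset by blast
  let ?subs = "{B. B \<subseteq> C \<and> B \<noteq> {}}"
  let ?t = "\<lambda>B. (- 1) ^ (card B + 1) * h (\<Inter>B)"
  have zero: "h (\<Inter>B) = 0" if "B \<in> ?subs - {C}" for B
  proof -
    have "card B < card C"
      using that fin by (intro psubset_card_mono) auto
    then show ?thesis
      using that less.prems by (intro less.hyps) auto
  qed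
  have "0 = h (\<Union>C)"
    using small less.prems by simp
  also have "\<dots> = sum ?t ?subs"
    using less.prems(1) P by (intro Incl_Excl.restricted[OF IE fin]) blast
  also have "\<dots> = ?t C + sum ?t (?subs - {C})"
    using fin less.prems by (intro sum.remove) auto
  also have "sum ?t (?subs - {C}) = 0"
    using zero by (intro sum.neutral) auto
  finally show ?case
    by simp
qed

text \<open>The hypothesis \<open>small\<close> concerns only unions of at most \<open>N\<close> members, while \<open>D\<close> may be larger:
  bounded multiplicity removes exactly those inclusion-exclusion terms about which \<open>small\<close> says
  nothing.\<close>

lemma zero_on_Union_of_bounded_multiplicity:
  fixes h :: "'a set \<Rightarrow> real"
  assumes IE: "Incl_Excl P h" and "finite D" and P: "\<And>S. S \<in> D \<Longrightarrow> P S"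
    and small: "\<And>C. C \<subseteq> D \<Longrightarrow> C \<noteq> {} \<Longrightarrow> card C \<le> N \<Longrightarrow> h (\<Union>C) = 0"
    and large: "\<And>C. C \<subseteq> D \<Longrightarrow> N < card C \<Longrightarrow> \<Inter>C = {}"
  shows "h (\<Union>D) = 0"
proof -
  have empty: "h {} = 0"
    by (rule Incl_Excl.f_empty[OF IE])
  have "h (\<Inter>C) = 0" if "C \<subseteq> D" "C \<noteq> {}" for C
  proof (cases "card C \<le> N")
    case True
    show ?thesis
      by (rule zero_on_small_Inter[OF IE \<open>finite D\<close>]) (use P small that True in auto)
  next
    case False
    then show ?thesis
      using large[of C] that empty by simp
  qed
  moreover have "h (\<Union>D) = (\<Sum>C | C \<subseteq> D \<and> C \<noteq> {}. (- 1) ^ (card C + 1) * h (\<Inter>C))"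
    by (rule Incl_Excl.restricted[OF IE \<open>finite D\<close> P])
  ultimately show ?thesis
    by simp
qed

lemma Incl_Excl_measure_diff:
  assumes "finite_measure M" and "finite_measure N" and "sets M = sets N"
  shows "Incl_Excl (\<lambda>S. S \<in> sets M) (\<lambda>S. measure M S - measure N S)"
  using assms
  by unfold_locales
    (auto simp: finite_measure.finite_measure_Union disjnt_def)

section \<open>The distance transform and unions of balls\<close>

lemma min_dist_less_iff: "min_dist n \<alpha> a x < t \<longleftrightarrow> (\<exists>i\<le>n. \<alpha> i * dist x (a i) < t)"
  by (auto simp: min_dist_def Min_less_iff)

text \<open>Balls \<open>ball (c i) (\<rho> i)\<close> with arbitrary radii form a sublevel set at height \<open>t\<close> once the weights
  are \<open>\<alpha>\<^sub>i = t / \<rho> i\<close>. These weights lie in \<open>[0, 1]\<close> as soon as \<open>t\<close> is at most every radius.\<close>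

lemma measure_small_Union_balls_eq:
  fixes \<mu> \<nu> :: "'a::metric_space measure"
  assumes \<mu>: "\<mu> \<in> borel_probs" and \<nu>: "\<nu> \<in> borel_probs"
    and eq: "dist_transform n \<mu> = dist_transform n \<nu>"
    and balls: "\<And>B. B \<in> \<C> \<Longrightarrow> \<exists>x r. 0 < r \<and> B = ball x r"
    and \<C>: "finite \<C>" "\<C> \<noteq> {}" "card \<C> \<le> n + 1"
  shows "measure \<mu> (\<Union>\<C>) = measure \<nu> (\<Union>\<C>)"
proof -
  obtain c \<rho> where c\<rho>: "\<And>B. B \<in> \<C> \<Longrightarrow> 0 < \<rho> B \<and> B = ball (c B) (\<rho> B)"
    using balls by metis
  \<comment> \<open>A tuple has exactly \<open>n + 1\<close> entries, so smaller families are listed with repetitions.\<close>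
  obtain g where g: "g ` {..n} = \<C>"
  proof -
    have "card \<C> \<le> card {..n}" using \<C> by simp
    then obtain f where f: "inj_on f \<C>" "f ` \<C> \<subseteq> {..n}"
      using card_le_inj[of \<C> "{..n}"] \<C> by auto
    obtain B0 where B0: "B0 \<in> \<C>" using \<C> by blast
    let ?g = "\<lambda>i. if i \<in> f ` \<C> then the_inv_into \<C> f i else B0"
    have "?g ` {..n} \<subseteq> \<C>"
      using B0 f the_inv_into_into[OF f(1) _ order_refl] by auto
    moreover have "B \<in> ?g ` {..n}" if "B \<in> \<C>" for B
      using that f by (intro image_eqI[of _ _ "f B"]) (auto simp: the_inv_into_f_f)
    ultimately have "?g ` {..n} = \<C>"
      by (intro equalityI subsetI) auto
    then show ?thesis
      by (rule that)
  qed
  have g_in: "g i \<in> \<C>" if "i \<le> n" for i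
    using that by (simp flip: g)
  define t where "t = Min (\<rho> ` \<C>)"
  have t: "0 < t" "\<And>B. B \<in> \<C> \<Longrightarrow> t \<le> \<rho> B"
    using c\<rho> \<C> by (auto simp: t_def)
  define \<alpha> where "\<alpha> i = t / \<rho> (g i)" for i
  define f where "f = min_dist n \<alpha> (c \<circ> g)"
  have "\<alpha> i \<in> {0..1}" if "i \<le> n" for i
    using t(1) t(2)[OF g_in[OF that]] by (simp add: \<alpha>_def)
  then have "f \<in> min_dist_fns n"
    unfolding f_def min_dist_fns_def by blast
  then have distr_eq: "distr \<mu> borel f = distr \<nu> borel f" and "f \<in> lip1_fns"
    using fun_cong[OF eq, of f] min_dist_fns_lip1 by (auto simp: dist_transform_def)
  have "\<alpha> i * dist x (c (g i)) < t \<longleftrightarrow> x \<in> g i" if "i \<le> n" for i x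
  proof -
    have pos: "0 < \<rho> (g i)" and g_ball: "g i = ball (c (g i)) (\<rho> (g i))"
      using c\<rho>[OF g_in[OF that]] by blast+
    have "\<alpha> i * dist x (c (g i)) < t \<longleftrightarrow> dist x (c (g i)) < \<rho> (g i)"
      using pos t(1) by (simp add: \<alpha>_def field_simps)
    also have "\<dots> \<longleftrightarrow> x \<in> ball (c (g i)) (\<rho> (g i))"
      by (simp add: dist_commute)
    finally show ?thesis
      by (simp flip: g_ball)
  qed
  then have "{x. f x < t} = \<Union>(g ` {..n})"
    unfolding f_def min_dist_less_iff comp_apply by blast
  then have vimage: "f -` {..<t} = \<Union>\<C>"
    by (auto simp: g)
  have "measure M (\<Union>\<C>) = measure (distr M borel f) {..<t}" if "M \<in> borel_probs" for M
  proof -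
    have "space M = UNIV"
      using that sets_eq_imp_space_eq[of M borel] by (simp add: borel_probs_def)
    then show ?thesis
      using lip1_fns_measurable[OF \<open>f \<in> lip1_fns\<close> that] by (simp add: measure_distr vimage)
  qed
  then show ?thesis
    using \<mu> \<nu> distr_eq by simp
qed

text \<open>Finite subfamilies inherit the bound on the multiplicity, so the inclusion-exclusion argument
  applies to each of them; a countable subfamily with the same union carries this over to the whole
  of \<open>\<B>\<close>.\<close>

lemma measure_Union_balls_eq:
  fixes \<mu> \<nu> :: "'a::{metric_space, second_countable_topology} measure"
  assumes \<mu>: "\<mu> \<in> borel_probs" and \<nu>: "\<nu> \<in> borel_probs"
    and eq: "dist_transform n \<mu> = dist_transform n \<nu>"
    and balls: "\<And>B. B \<in> \<B> \<Longrightarrow> \<exists>x r. 0 < r \<and> B = ball x r"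
    and mult: "\<And>\<C>. \<C> \<subseteq> \<B> \<Longrightarrow> finite \<C> \<Longrightarrow> card \<C> > n + 1 \<Longrightarrow> \<Inter>\<C> = {}"
  shows "measure \<mu> (\<Union>\<B>) = measure \<nu> (\<Union>\<B>)"
proof -
  have M: "finite_measure M" "sets M = sets borel" if "M \<in> borel_probs" for M :: "'a measure"
    using that prob_space.finite_measure by (auto simp: borel_probs_def)
  have \<B>_open: "open B" if "B \<in> \<B>" for B
    using balls[OF that] by auto
  have fin: "measure \<mu> (\<Union>\<D>) = measure \<nu> (\<Union>\<D>)" if "finite \<D>" "\<D> \<subseteq> \<B>" for \<D>
  proof -
    have "measure \<mu> (\<Union>\<D>) - measure \<nu> (\<Union>\<D>) = 0"
    proof (rule zero_on_Union_of_bounded_multiplicity[OF Incl_Excl_measure_diff \<open>finite \<D>\<close>])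
      show "finite_measure \<mu>" "finite_measure \<nu>" "sets \<mu> = sets \<nu>"
        using M[OF \<mu>] M[OF \<nu>] by simp_all
      show "S \<in> sets \<mu>" if "S \<in> \<D>" for S
        using \<B>_open[of S] that \<open>\<D> \<subseteq> \<B>\<close> by (auto simp: M(2)[OF \<mu>])
      show "measure \<mu> (\<Union>\<C>) - measure \<nu> (\<Union>\<C>) = 0"
        if "\<C> \<subseteq> \<D>" "\<C> \<noteq> {}" "card \<C> \<le> n + 1" for \<C>
      proof -
        have "\<exists>x r. 0 < r \<and> B = ball x r" if "B \<in> \<C>" for B
          using that \<open>\<C> \<subseteq> \<D>\<close> \<open>\<D> \<subseteq> \<B>\<close> by (intro balls) blast
        then show ?thesis
          using measure_small_Union_balls_eq[OF \<mu> \<nu> eq, of \<C>] that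
            finite_subset[OF that(1) \<open>finite \<D>\<close>] by simp
      qed
      show "\<Inter>\<C> = {}" if "\<C> \<subseteq> \<D>" "n + 1 < card \<C>" for \<C>
        using that \<open>\<D> \<subseteq> \<B>\<close> finite_subset[OF that(1) \<open>finite \<D>\<close>] by (intro mult) auto
    qed
    then show ?thesis by simp
  qed
  obtain \<F> where \<F>: "\<F> \<subseteq> \<B>" "countable \<F>" "\<Union>\<F> = \<Union>\<B>"
    using Lindelof[of \<B>] \<B>_open by metis
  show ?thesis
  proof (cases "\<F> = {}")
    case True
    then show ?thesis
      using \<F>(3)[symmetric] by (simp only: Union_empty measure_empty)
  next
    case False
    define A where "A k = \<Union>(from_nat_into \<F> ` {..k})" for k
    have A_mono: "incseq A"
      unfolding A_def by (intro monoI Union_mono image_mono) simp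
    have range: "from_nat_into \<F> ` {..k} \<subseteq> \<B>" for k
      using from_nat_into[OF False] \<F>(1) by auto
    have "(\<Union>k. A k) = \<Union>(range (from_nat_into \<F>))"
      unfolding A_def by auto
    then have A_Un: "(\<Union>k. A k) = \<Union>\<B>"
      using range_from_nat_into[OF False \<F>(2)] \<F>(3) by simp
    have A_open: "open (A k)" for k
      using range[of k] \<B>_open unfolding A_def by (intro open_Union) blast
    have lim: "(\<lambda>k. measure M (A k)) \<longlonglongrightarrow> measure M (\<Union>\<B>)" if "M \<in> borel_probs" for M
      using finite_measure.finite_Lim_measure_incseq[OF M(1)[OF that], of A]
        A_mono A_open M(2)[OF that] by (simp add: A_Un image_subset_iff)
    have "measure \<mu> (A k) = measure \<nu> (A k)" for k
      using fin[OF _ range] by (simp add: A_def)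
    then show ?thesis
      using lim[OF \<mu>] lim[OF \<nu>] LIMSEQ_unique by simp
  qed
qed

section \<open>Supports of finite metric covering dimension\<close>

text \<open>The complement of the support is the union of all open null sets, and in a second countable
  space countably many of them have the same union.\<close>

lemma null_complement_msupport:
  fixes \<mu> :: "'a::second_countable_topology measure"
  assumes "sets \<mu> = sets borel"
  shows "- msupport \<mu> \<in> null_sets \<mu>"
proof -
  let ?\<N> = "{U. open U \<and> emeasure \<mu> U = 0}"
  have "- msupport \<mu> = \<Union>?\<N>"
    by (auto simp: msupport_def zero_less_iff_neq_zero)
  moreover obtain \<F> where \<F>: "\<F> \<subseteq> ?\<N>" "countable \<F>" "\<Union>\<F> = \<Union>?\<N>"
    using Lindelof[of ?\<N>] by blast
  moreover have "(\<Union>U\<in>\<F>. U) \<in> null_sets \<mu>"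
    using \<F> assms by (intro null_sets_UN') (auto simp: null_sets_def)
  ultimately show ?thesis by simp
qed

text \<open>An infimum of extended naturals below \<open>Suc n\<close> has a witness \<open>m \<le> n\<close> among the elements, and
  having dimension at most \<open>m\<close> is a stronger condition than having dimension at most \<open>n\<close>.\<close>

lemma ball_dim_le_msupport:
  assumes "\<mu> \<in> probs_dim n"
  shows "ball_dim_le (msupport \<mu>) n"
proof -
  have "metric_cov_dim (msupport \<mu>) \<le> enat n"
    using assms by (auto simp: probs_dim_def probs_dim_le_def split: if_splits)
  then have lt: "Inf {enat k |k. ball_dim_le (msupport \<mu>) k} < enat (Suc n)"
    unfolding metric_cov_dim_def by (rule order.strict_trans1) simp
  obtain m where m: "ball_dim_le (msupport \<mu>) m" "m \<le> n"
    using lt unfolding Inf_less_iff by auto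
  show ?thesis
    unfolding ball_dim_le_def
  proof (intro allI impI)
    fix \<U> :: "'a set set"
    assume "(\<forall>U\<in>\<U>. open U) \<and> msupport \<mu> \<subseteq> \<Union>\<U>"
    then obtain \<B> where \<B>: "\<forall>B\<in>\<B>. \<exists>x r. 0 < r \<and> B = ball x r" "msupport \<mu> \<subseteq> \<Union>\<B>"
        "\<forall>B\<in>\<B>. \<exists>U\<in>\<U>. B \<subseteq> U"
      and mult: "\<And>\<C>. \<C> \<subseteq> \<B> \<Longrightarrow> finite \<C> \<Longrightarrow> card \<C> > m + 1 \<Longrightarrow> \<Inter>\<C> = {}"
      using m(1)[unfolded ball_dim_le_def, rule_format, of \<U>] by auto
    have "\<Inter>\<C> = {}" if "\<C> \<subseteq> \<B>" "finite \<C> \<and> card \<C> > n + 1" for \<C>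
      using mult[of \<C>] that m(2) by simp
    with \<B> show "\<exists>\<B>. (\<forall>B\<in>\<B>. \<exists>x r. 0 < r \<and> B = ball x r) \<and> msupport \<mu> \<subseteq> \<Union>\<B> \<and>
            (\<forall>B\<in>\<B>. \<exists>U\<in>\<U>. B \<subseteq> U) \<and>
            (\<forall>\<C>\<subseteq>\<B>. finite \<C> \<and> card \<C> > n + 1 \<longrightarrow> \<Inter>\<C> = {})"
      by (intro exI[of _ \<B>] conjI) auto
  qed
qed

lemma probs_dim_borel_probs: "\<mu> \<in> probs_dim n \<Longrightarrow> \<mu> \<in> borel_probs"
  by (auto simp: probs_dim_def probs_dim_le_def split: if_splits)

text \<open>Both members of the cover \<open>{U, - K}\<close> serve a purpose: a ball of the refinement that meets \<open>K\<close>
  cannot lie in \<open>- K\<close>, so it lies in \<open>U\<close>. The balls in \<open>U\<close> thus cover the part of \<open>K\<close> in the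
  support of \<open>\<mu>\<close>, and \<open>\<mu>\<close> and \<open>\<nu>\<close> agree on their union. The
  cover sees only the support of \<open>\<mu>\<close>, whence an inequality, to be used in both directions.\<close>

lemma measure_closed_le_open:
  fixes \<mu> \<nu> :: "'a::{metric_space, second_countable_topology} measure"
  assumes \<mu>: "\<mu> \<in> borel_probs" and \<nu>: "\<nu> \<in> borel_probs"
    and dim: "ball_dim_le (msupport \<mu>) n"
    and eq: "dist_transform n \<mu> = dist_transform n \<nu>"
    and K: "closed K" and U: "open U" "K \<subseteq> U"
  shows "measure \<mu> K \<le> measure \<nu> U"
proof -
  interpret \<mu>: prob_space \<mu> using \<mu> by (simp add: borel_probs_def)
  interpret \<nu>: prob_space \<nu> using \<nu> by (simp add: borel_probs_def)
  have sets: "sets \<mu> = sets borel" "sets \<nu> = sets borel"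
    using \<mu> \<nu> by (auto simp: borel_probs_def)
  have "\<exists>\<B>. (\<forall>B\<in>\<B>. \<exists>x r. 0 < r \<and> B = ball x r) \<and> msupport \<mu> \<subseteq> \<Union>\<B> \<and>
            (\<forall>B\<in>\<B>. \<exists>V\<in>{U, - K}. B \<subseteq> V) \<and>
            (\<forall>\<C>\<subseteq>\<B>. finite \<C> \<and> card \<C> > n + 1 \<longrightarrow> \<Inter>\<C> = {})"
    using K U by (intro dim[unfolded ball_dim_le_def, rule_format]) auto
  then obtain \<B> where \<B>: "\<forall>B\<in>\<B>. \<exists>x r. 0 < r \<and> B = ball x r"
      "\<forall>B\<in>\<B>. \<exists>V\<in>{U, - K}. B \<subseteq> V"
      "\<forall>\<C>\<subseteq>\<B>. finite \<C> \<and> card \<C> > n + 1 \<longrightarrow> \<Inter>\<C> = {}"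
    and cover: "msupport \<mu> \<subseteq> \<Union>\<B>"
    by (elim exE conjE) (rule that)
  note balls = \<B>(1)[rule_format] and mult = \<B>(3)[rule_format, OF _ conjI]
  have refine: "B \<subseteq> U \<or> B \<subseteq> - K" if "B \<in> \<B>" for B
    using \<B>(2) that by blast
  let ?\<B>U = "{B \<in> \<B>. B \<subseteq> U}"
  have "open B" if "B \<in> \<B>" for B
    using balls[OF that] by auto
  then have opn: "open (\<Union>?\<B>U)"
    by (intro open_Union) blast
  have sub: "K \<subseteq> \<Union>?\<B>U \<union> - msupport \<mu>"
    using cover refine by blast
  have "measure \<mu> K \<le> measure \<mu> (\<Union>?\<B>U \<union> - msupport \<mu>)"
    using sub opn closed_msupport[of \<mu>] sets by (intro \<mu>.finite_measure_mono) auto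
  also have "\<dots> = measure \<mu> (\<Union>?\<B>U)"
    using null_complement_msupport[OF sets(1)] opn sets by (intro measure_Un_null_set) auto
  also have "\<dots> = measure \<nu> (\<Union>?\<B>U)"
    by (rule measure_Union_balls_eq[OF \<mu> \<nu> eq]) (use balls in simp, use mult in blast)
  also have "\<dots> \<le> measure \<nu> U"
    using U sets by (intro \<nu>.finite_measure_mono) auto
  finally show ?thesis .
qed

lemma emeasure_closed_le:
  fixes \<mu> \<nu> :: "'a::polish_space measure"
  assumes \<mu>: "\<mu> \<in> borel_probs" and \<nu>: "\<nu> \<in> borel_probs"
    and dim: "ball_dim_le (msupport \<mu>) n"
    and eq: "dist_transform n \<mu> = dist_transform n \<nu>"
    and K: "closed K"
  shows "emeasure \<mu> K \<le> emeasure \<nu> K"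
proof -
  interpret \<mu>: prob_space \<mu> using \<mu> by (simp add: borel_probs_def)
  interpret \<nu>: prob_space \<nu> using \<nu> by (simp add: borel_probs_def)
  have sets: "sets \<nu> = sets borel"
    using \<nu> by (simp add: borel_probs_def)
  have "emeasure \<nu> K = (INF U\<in>{U. K \<subseteq> U \<and> open U}. emeasure \<nu> U)"
    using K by (intro outer_regular[OF sets]) auto
  also have "emeasure \<mu> K \<le> \<dots>"
    using measure_closed_le_open[OF \<mu> \<nu> dim eq K]
    by (intro INF_greatest) (simp add: \<mu>.emeasure_eq_measure \<nu>.emeasure_eq_measure)
  finally show ?thesis .
qed

theorem theorem10:
  fixes \<mu> \<nu> :: "'a::polish_space measure" and n :: nat
  assumes "\<mu> \<in> probs_dim n" and "\<nu> \<in> probs_dim n"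
  shows "dist_transform n \<mu> = dist_transform n \<nu> \<longleftrightarrow> \<mu> = \<nu>"
proof
  assume eq: "dist_transform n \<mu> = dist_transform n \<nu>"
  note \<mu> = probs_dim_borel_probs[OF assms(1)] and \<nu> = probs_dim_borel_probs[OF assms(2)]
  have closed_eq: "emeasure \<mu> K = emeasure \<nu> K" if "closed K" for K
    using emeasure_closed_le[OF \<mu> \<nu> ball_dim_le_msupport[OF assms(1)] eq that]
      emeasure_closed_le[OF \<nu> \<mu> ball_dim_le_msupport[OF assms(2)] eq[symmetric] that]
    by (rule antisym)
  interpret \<mu>: prob_space \<mu> using \<mu> by (simp add: borel_probs_def)
  have gen: "sets (borel :: 'a measure) = sigma_sets UNIV (Collect closed)"
    by (simp add: borel_eq_closed)
  show "\<mu> = \<nu>"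
  proof (rule measure_eqI_generator_eq[where E = "Collect closed" and \<Omega> = UNIV and A = "\<lambda>_. UNIV"])
    show "Int_stable (Collect closed :: 'a set set)"
      by (auto simp: Int_stable_def)
    show "sets \<mu> = sigma_sets UNIV (Collect closed)" "sets \<nu> = sigma_sets UNIV (Collect closed)"
      using \<mu> \<nu> gen by (auto simp: borel_probs_def)
    show "emeasure \<mu> UNIV \<noteq> \<infinity>"
      by simp
  qed (use closed_eq in auto)
next
  assume "\<mu> = \<nu>"
  then show "dist_transform n \<mu> = dist_transform n \<nu>"
    by simp
qed

end
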